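(* For arbitrary $su(n)$, let $F_a$ and $D_a$, $a=1,\dots,n^2-1$, be the (antihermitian, respectively hermitian) traceless matrices $(F_a)_{bc}=f_{bac}$ and $(D_a)_{bc}=d_{abc}$, $a,b,c=1,\dots,n^2-1$. Then $$\mathrm{Tr}\,F_aF_bF_cF_d=\delta_{ab}\delta_{cd}+\delta_{ad}\delta_{bc}+\frac n4\,(d_{abx}d_{cdx}+d_{adx}d_{bcx}-d_{acx}d_{bdx}),$$ $$\mathrm{Tr}\,F_aF_bF_cD_d=-\frac n4\,d_{abx}f_{cdx}-\frac n4\,f_{abx}d_{cdx},$$ $$\mathrm{Tr}\,F_aF_bD_cD_d=\frac{4-n^2}{n^2}(\delta_{ab}\delta_{cd}-\delta_{ac}\delta_{bd})+\frac{8-n^2}{4n}(d_{abx}d_{cdx}-d_{acx}d_{bdx})-\frac n4\,d_{adx}d_{bcx},$$ $$\mathrm{Tr}\,F_aD_bF_cD_d=\frac n4\,(d_{acx}d_{bdx}-d_{adx}d_{bcx})-\frac n4\,d_{abx}d_{cdx},$$ $$\mathrm{Tr}\,F_aD_bD_cD_d=\frac{n^2-12}{4n}\,f_{abx}d_{cdx}+\frac n4\,d_{abx}f_{cdx}+\frac1n\,(f_{adx}d_{bcx}-f_{acx}d_{bdx}),$$ $$\mathrm{Tr}\,D_aD_bD_cD_d=\frac{n^2-4}{n^2}(\delta_{ab}\delta_{cd}+\delta_{ad}\delta_{bc})-\frac n4\,d_{acx}d_{bdx}+\frac{n^2-16}{4n}(d_{abx}d_{cdx}+d_{adx}d_{b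cx}).$$
   Context: The $su(n)$ tensors $f_{abc}$ (totally antisymmetric) and $d_{abc}$ (totally symmetric, traceless) are defined from a basis of hermitian traceless $n\times n$ matrices $T_a$, $a=1,\dots,n^2-1$, normalised by $\mathrm{Tr}(T_aT_b)=\frac12\delta_{ab}$, through $[T_a,T_b]=i f_{abc}T_c$ and $\{T_a,T_b\}=\frac1n\delta_{ab}+d_{abc}T_c$ (the term $\frac1n\delta_{ab}$ multiplies the unit matrix). Repeated indices are summed from $1$ to $n^2-1$. *)

theory Defs
  imports "HOL-Analysis.Analysis"
begin

definition kdelta :: "'a \<Rightarrow> 'a \<Rightarrow> complex" where
  "kdelta a b = (if a = b then 1 else 0)"

definition conj_transpose :: "complex^'n^'m \<Rightarrow> complex^'m^'n" where
  "conj_transpose A = transpose (map_matrix cnj A)"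

definition hermitian :: "complex^'n^'n \<Rightarrow> bool" where
  "hermitian A \<longleftrightarrow> conj_transpose A = A"

definition antihermitian :: "complex^'n^'n \<Rightarrow> bool" where
  "antihermitian A \<longleftrightarrow> conj_transpose A = - A"

text \<open>The library scales complex matrices only by reals.\<close>

definition cscale :: "complex \<Rightarrow> complex^'n^'m \<Rightarrow> complex^'n^'m" where
  "cscale k A = map_matrix (\<lambda>z. k * z) A"

text \<open>
  The size \<open>n\<close> is \<open>CARD('n)\<close>, and the type \<open>'k\<close> plays the role of the index range
  \<open>1, \<dots>, n\<^sup>2 - 1\<close>; since types are nonempty, the cardinality condition forces \<open>n \<ge> 2\<close>.
  Here \<open>independent\<close> and \<open>span\<close> are taken over the reals: the hermitian traceless matrices
  form a real, not a complex, vector space.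
\<close>

definition su_basis :: "('k::finite \<Rightarrow> complex^'n^'n) \<Rightarrow> bool" where
  "su_basis T \<longleftrightarrow>
     CARD('k) = CARD('n)^2 - 1 \<and>
     inj T \<and> independent (range T) \<and> span (range T) = {A. hermitian A \<and> trace A = 0} \<and>
     (\<forall>a b. trace (T a ** T b) = kdelta a b / 2)"

text \<open>
  The coefficients are complex-valued; that they are real, and the symmetries of \<open>f\<close> and \<open>d\<close>,
  are consequences of \<open>su_basis\<close> and the two relations below, and so are not assumed.
\<close>

definition su_tensors ::
  "('k::finite \<Rightarrow> complex^'n^'n) \<Rightarrow> ('k \<Rightarrow> 'k \<Rightarrow> 'k \<Rightarrow> complex) \<Rightarrow> ('k \<Rightarrow> 'k \<Rightarrow> 'k \<Rightarrow> complex) \<Rightarrow> bool"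
where
  "su_tensors T f d \<longleftrightarrow> su_basis T \<and>
     (\<forall>a b. T a ** T b - T b ** T a = (\<Sum>c\<in>UNIV. cscale (\<i> * f a b c) (T c))) \<and>
     (\<forall>a b. T a ** T b + T b ** T a
            = mat (kdelta a b / of_nat CARD('n)) + (\<Sum>c\<in>UNIV. cscale (d a b c) (T c)))"

text \<open>Note the index order \<open>f\<^sub>b\<^sub>a\<^sub>c\<close>: this is minus the matrix with entries \<open>f\<^sub>a\<^sub>b\<^sub>c\<close>.\<close>

definition F_matrix :: "('k \<Rightarrow> 'k \<Rightarrow> 'k \<Rightarrow> complex) \<Rightarrow> 'k \<Rightarrow> complex^'k^'k" where
  "F_matrix f a = (\<chi> b c. f b a c)"

definition D_matrix :: "('k \<Rightarrow> 'k \<Rightarrow> 'k \<Rightarrow> complex) \<Rightarrow> 'k \<Rightarrow> complex^'k^'k" where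
  "D_matrix d a = (\<chi> b c. d a b c)"

text \<open>\<open>contract X Y a b c e\<close> is \<open>X\<^sub>a\<^sub>b\<^sub>x Y\<^sub>c\<^sub>e\<^sub>x\<close> with \<open>x\<close> summed.\<close>

definition contract ::
  "('k::finite \<Rightarrow> 'k \<Rightarrow> 'k \<Rightarrow> complex) \<Rightarrow> ('k \<Rightarrow> 'k \<Rightarrow> 'k \<Rightarrow> complex) \<Rightarrow> 'k \<Rightarrow> 'k \<Rightarrow> 'k \<Rightarrow> 'k \<Rightarrow> complex"
where
  "contract X Y a b c e = (\<Sum>x\<in>UNIV. X a b x * Y c e x)"

end

(* Completeness of the generators, X = (tr X / n) 1 + 2 sum_c tr(X T_c) T_c, yields the two Fierz
   contractions
     sum_c tr(A T_c) tr(T_c B) = (tr(A B) - tr A tr B / n) / 2,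
     sum_c tr(A T_c B T_c)     = (tr A tr B - tr(A B) / n) / 2.
   The entries of F_a and D_a are traces of three generators, so the summed indices on both sides
   of each identity can be contracted away; what remains is a linear relation between traces of
   four generators and products of Kronecker deltas. *)

theory Submission
  imports Defs
begin

section \<open>Entries, products and traces of complex matrices\<close>

lemma cscale_nth [simp]: "cscale k A $ i $ j = k * A $ i $ j"
  by (simp add: cscale_def)

lemma kdelta_commute: "kdelta a b = kdelta b a"
  by (simp add: kdelta_def)

lemma sum_kdelta:
  fixes g :: "'a::finite \<Rightarrow> complex"
  shows "(\<Sum>c\<in>UNIV. g c * kdelta c a) = g a" "(\<Sum>c\<in>UNIV. g c * kdelta a c) = g a"
  by (simp_all add: kdelta_def if_distrib cong: if_cong)

lemma conj_transpose_nth [simp]: "conj_transpose A $ i $ j = cnj (A $ j $ i)"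
  by (simp add: conj_transpose_def transpose_def)

lemma matrix_mult_nth: "(A ** B) $ i $ j = (\<Sum>k\<in>UNIV. A $ i $ k * B $ k $ j)"
  by (simp add: matrix_matrix_mult_def)

lemma mat_nth: "mat k $ i $ j = k * kdelta i j"
  by (simp add: mat_def kdelta_def)

lemma trace_cscale: "trace (cscale k A) = k * trace A"
  by (simp add: trace_def sum_distrib_left)

lemma trace_sum: "trace (\<Sum>c\<in>S. g c) = (\<Sum>c\<in>S. trace (g c :: complex^'n^'n))"
  by (simp add: trace_def sum.swap[of _ S])

lemma trace_mat: "trace (mat k :: complex^'n^'n) = of_nat CARD('n) * k"
  by (simp add: trace_def mat_def)

lemma cscale_mult_right: "A ** cscale k B = cscale k (A ** B)"
  by (simp add: vec_eq_iff matrix_mult_nth sum_distrib_left mult_ac)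

lemma cscale_mult_left: "cscale k A ** B = cscale k (A ** B)"
  by (simp add: vec_eq_iff matrix_mult_nth sum_distrib_left mult.assoc)

lemma mat_mult_left: "mat k ** (B :: complex^'n^'n) = cscale k B"
  by (simp add: vec_eq_iff matrix_mult_nth mat_def if_distrib if_distribR sum.delta cong: if_cong)

lemma sum_mult_left: "(\<Sum>c\<in>S. g c) ** (B :: complex^'n^'n) = (\<Sum>c\<in>S. g c ** B)"
  by (simp add: vec_eq_iff matrix_mult_nth sum_distrib_right sum.swap[of _ S])

lemma matrix_add_rdistrib: "(A + B) ** (C :: complex^'n^'n) = A ** C + B ** C"
  by (simp add: vec_eq_iff matrix_mult_nth sum.distrib distrib_right)

lemma matrix_diff_rdistrib: "(A - B) ** (C :: complex^'n^'n) = A ** C - B ** C"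
  by (simp add: vec_eq_iff matrix_mult_nth sum_subtractf left_diff_distrib)

lemma conj_transpose_mult: "conj_transpose (A ** B) = conj_transpose B ** conj_transpose A"
  by (simp add: vec_eq_iff matrix_mult_nth cnj_sum mult.commute)

lemma trace_conj_transpose: "trace (conj_transpose A) = cnj (trace A)"
  by (simp add: trace_def cnj_sum)

lemma trace_mult_nth: "trace (A ** B) = (\<Sum>i\<in>UNIV. \<Sum>j\<in>UNIV. A $ i $ j * B $ j $ i)"
  by (simp add: trace_def matrix_mult_nth)

section \<open>Completeness of the generators\<close>

locale su_generators =
  fixes T :: "'k::finite \<Rightarrow> complex^'n^'n" and n :: complex
  assumes basis: "su_basis T" and n_def: "n = of_nat CARD('n)"
begin

lemma n_nonzero [simp]: "n \<noteq> 0"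
  by (simp add: n_def)

lemma generator: "hermitian (T a)" "trace (T a) = 0"
  using basis span_base[of "T a" "range T"] unfolding su_basis_def by auto

lemma trace_generators: "trace (T a ** T b) = kdelta a b / 2"
  using basis unfolding su_basis_def by blast

text \<open>A predicate on a single matrix, so that completeness can be carried from hermitian
  traceless matrices to all matrices through sums and complex multiples. The factor 2 undoes the
  normalisation \<open>trace (T a ** T b) = kdelta a b / 2\<close>.\<close>

definition expands :: "complex^'n^'n \<Rightarrow> bool" where
  "expands A \<longleftrightarrow> A = mat (trace A / n) + (\<Sum>c\<in>UNIV. cscale (2 * trace (A ** T c)) (T c))"

lemma expands_add: "expands A \<Longrightarrow> expands B \<Longrightarrow> expands (A + B)"
  unfolding expands_def
  by (simp add: vec_eq_iff trace_add matrix_add_rdistrib mat_def sum.distrib algebra_simps add_divide_distrib)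

lemma expands_cscale: "expands A \<Longrightarrow> expands (cscale k A)"
  unfolding expands_def
  by (simp add: vec_eq_iff trace_cscale cscale_mult_left mat_def distrib_left sum_distrib_left mult_ac)

lemma expands_mat: "expands (mat k)"
  unfolding expands_def
  by (simp add: trace_mat mat_mult_left trace_cscale generator vec_eq_iff n_def)

text \<open>The spanning condition supplies real coefficients; multiplying by \<open>T a\<close> and
  taking the trace isolates half of the coefficient of \<open>T a\<close>.\<close>

lemma expands_hermitian:
  assumes "hermitian A" "trace A = 0"
  shows "expands A"
proof -
  have "A \<in> span (range T)" and T: "inj T"
    using basis assms by (auto simp: su_basis_def)
  then obtain u where "A = (\<Sum>v\<in>range T. u v *\<^sub>R v)"
    by (auto simp: span_finite)
  \<comment> \<open>The span attaches coefficients to matrices; injectivity of \<open>T\<close>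
    turns this into a sum over indices.\<close>
  then have "A = (\<Sum>c\<in>UNIV. u (T c) *\<^sub>R T c)"
    using T by (simp add: sum.reindex)
  then have A: "A = (\<Sum>c\<in>UNIV. cscale (of_real (u (T c))) (T c))"
    by (simp add: vec_eq_iff scaleR_conv_of_real[where 'a = complex])
  have "2 * trace (A ** T a) = of_real (u (T a))" for a
    by (subst A) (simp add: sum_mult_left trace_sum cscale_mult_left trace_cscale trace_generators
        sum_divide_distrib[symmetric] sum_kdelta)
  with A assms show ?thesis
    by (simp add: expands_def vec_eq_iff del: mult_2)
qed

text \<open>The generators span only a real space. Removing the trace part and then splitting into
  hermitian and antihermitian parts reaches every complex matrix.\<close>

lemma expands: "expands A"
proof -
  define B where "B = A + mat (- trace A / n)"
  have B0: "trace B = 0"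
    by (simp add: B_def trace_add trace_mat n_def)
  \<comment> \<open>The factor \<open>- \<i>/2\<close> makes \<open>?K\<close> hermitian and gives
    \<open>B = ?H + cscale \<i> ?K\<close>.\<close>
  let ?H = "cscale (1/2) (B + conj_transpose B)" and ?K = "cscale (- \<i>/2) (B - conj_transpose B)"
  have "hermitian ?H" "hermitian ?K"
    by (simp_all add: hermitian_def vec_eq_iff algebra_simps)
  moreover have "trace ?H = 0" "trace ?K = 0"
    by (simp_all add: trace_cscale trace_add trace_sub trace_conj_transpose B0)
  ultimately have "expands ((?H + cscale \<i> ?K) + mat (trace A / n))"
    by (intro expands_add expands_cscale expands_mat expands_hermitian)
  also have "(?H + cscale \<i> ?K) + mat (trace A / n) = A"
    by (simp add: vec_eq_iff B_def mat_def field_simps)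
  finally show ?thesis .
qed

section \<open>Fierz contractions\<close>

lemma sum_trace_trace:
  "(\<Sum>c\<in>UNIV. trace (A ** T c) * trace (T c ** B)) = (trace (A ** B) - trace A * trace B / n) / 2"
proof -
  have "trace (A ** B) = trace ((mat (trace A / n) + (\<Sum>c\<in>UNIV. cscale (2 * trace (A ** T c)) (T c))) ** B)"
    using expands[of A] by (simp add: expands_def)
  also have "\<dots> = trace A * trace B / n + 2 * (\<Sum>c\<in>UNIV. trace (A ** T c) * trace (T c ** B))"
    by (simp add: matrix_add_rdistrib mat_mult_left sum_mult_left cscale_mult_left trace_add
        trace_cscale trace_sum sum_distrib_left mult.assoc)
  finally show ?thesis by simp
qed

lemma fierz:
  "(\<Sum>c\<in>UNIV. T c $ i $ l * T c $ k $ j) = (kdelta i j * kdelta k l - kdelta i l * kdelta k j / n) / 2"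
proof -
  \<comment> \<open>The matrix unit with its 1 at position \<open>(l, i)\<close>: its trace against
    \<open>T c\<close> reads off the entry \<open>T c $ i $ l\<close>, so completeness becomes an
    identity between entries.\<close>
  let ?A = "(\<chi> p q. kdelta p l * kdelta q i) :: complex^'n^'n"
  have "trace (?A ** T c) = T c $ i $ l" for c
  proof -
    have "trace (?A ** T c) = (\<Sum>p\<in>UNIV. \<Sum>q\<in>UNIV. T c $ q $ p * kdelta p l * kdelta q i)"
      by (simp add: trace_mult_nth mult_ac)
    then show ?thesis by (simp only: sum_kdelta)
  qed
  moreover have "trace ?A = kdelta i l"
    using sum_kdelta(1)[of "\<lambda>p. kdelta p i" l] by (simp add: trace_def kdelta_commute mult.commute)
  ultimately have "?A = mat (kdelta i l / n) + (\<Sum>c\<in>UNIV. cscale (2 * T c $ i $ l) (T c))"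
    using expands[of ?A] by (simp add: expands_def)
  then have "?A $ k $ j = (mat (kdelta i l / n) + (\<Sum>c\<in>UNIV. cscale (2 * T c $ i $ l) (T c))) $ k $ j"
    by simp
  then have "kdelta k l * kdelta j i
      = kdelta i l * kdelta k j / n + 2 * (\<Sum>c\<in>UNIV. T c $ i $ l * T c $ k $ j)"
    by (simp add: mat_nth sum_distrib_left mult.assoc)
  then show ?thesis
    by (simp add: kdelta_commute[of j i] mult.commute)
qed

text \<open>Contracting \<open>fierz\<close> with the entries \<open>B $ l $ k\<close>: the first
  product of deltas closes \<open>B\<close> into its trace, the second reproduces
  \<open>B\<close>.\<close>

lemma sum_generators_around:
  "(\<Sum>c\<in>UNIV. T c ** B ** T c) = cscale (1/2) (mat (trace B) - cscale (1/n) B)"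
proof -
  have "(\<Sum>c\<in>UNIV. T c ** B ** T c) $ i $ j = (mat (trace B) - cscale (1/n) B) $ i $ j / 2" for i j
  proof -
    have "(\<Sum>c\<in>UNIV. T c ** B ** T c) $ i $ j
        = (\<Sum>c\<in>UNIV. \<Sum>k\<in>UNIV. \<Sum>l\<in>UNIV. B $ l $ k * (T c $ i $ l * T c $ k $ j))"
      by (simp add: matrix_mult_nth sum_distrib_right sum_distrib_left mult_ac)
    also have "\<dots> = (\<Sum>k\<in>UNIV. \<Sum>c\<in>UNIV. \<Sum>l\<in>UNIV. B $ l $ k * (T c $ i $ l * T c $ k $ j))"
      by (rule sum.swap)
    also have "\<dots> = (\<Sum>k\<in>UNIV. \<Sum>l\<in>UNIV. B $ l $ k * (\<Sum>c\<in>UNIV. T c $ i $ l * T c $ k $ j))"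
      by (rule sum.cong[OF refl], subst sum.swap) (simp add: sum_distrib_left)
    also have "\<dots> = (\<Sum>k\<in>UNIV. \<Sum>l\<in>UNIV. B $ l $ k * kdelta i j * kdelta k l / 2
        - B $ l $ k * kdelta i l * kdelta k j / n / 2)"
      by (simp add: fierz field_simps)
    also have "\<dots> = (\<Sum>k\<in>UNIV. B $ k $ k) * kdelta i j / 2 - B $ i $ j / n / 2"
    proof -
      have "(\<Sum>l\<in>UNIV. B $ l $ k * kdelta i l * kdelta k j) = B $ i $ k * kdelta k j" for k
        using sum_kdelta(2)[of "\<lambda>l. B $ l $ k * kdelta k j" i] by (simp add: mult_ac)
      then show ?thesis
        unfolding sum_subtractf sum_divide_distrib[symmetric]
        by (simp only: sum_kdelta sum_distrib_right)
    qed
    also have "\<dots> = (mat (trace B) - cscale (1/n) B) $ i $ j / 2"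
      by (simp add: mat_nth trace_def diff_divide_distrib)
    finally show ?thesis .
  qed
  then show ?thesis
    by (simp add: vec_eq_iff)
qed

lemma sum_trace_around:
  "(\<Sum>c\<in>UNIV. trace (T c ** A ** T c ** B)) = (trace A * trace B - trace (A ** B) / n) / 2"
proof -
  have "(\<Sum>c\<in>UNIV. trace (T c ** A ** T c ** B)) = trace ((\<Sum>c\<in>UNIV. T c ** A ** T c) ** B)"
    by (simp add: sum_mult_left trace_sum)
  then show ?thesis
    by (simp add: sum_generators_around cscale_mult_left matrix_diff_rdistrib mat_mult_left trace_cscale trace_sub)
qed

section \<open>Kernels on the index space and their composition\<close>

text \<open>Half the matrix, in the basis \<open>T\<close>, of the map sending \<open>X\<close> to
  the traceless part of \<open>A ** X ** B\<close>.\<close>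

definition sandwich :: "complex^'n^'n \<Rightarrow> complex^'n^'n \<Rightarrow> 'k \<Rightarrow> 'k \<Rightarrow> complex" where
  "sandwich A B x y = trace (T x ** A ** T y ** B)"

text \<open>The shape of the \<open>1/n\<close> correction that arises when sandwiches are
  composed.\<close>

definition rank_one :: "complex^'n^'n \<Rightarrow> complex^'n^'n \<Rightarrow> 'k \<Rightarrow> 'k \<Rightarrow> complex" where
  "rank_one U V x y = trace (T x ** U) * trace (T y ** V)"

lemma sandwich_alt:
  "sandwich A B x y = trace ((B ** T x ** A) ** T y)" "sandwich A B x y = trace (T x ** (A ** T y ** B))"
  by (simp_all add: sandwich_def matrix_mul_assoc trace_mul_sym[of _ B])

text \<open>Composing the maps nests the outer factors as \<open>A ** C\<close> and
  \<open>E ** B\<close>. The rank-one term appears because the intermediate sum omits the unit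
  matrix direction.\<close>

lemma sandwich_compose:
  "(\<Sum>y\<in>UNIV. sandwich A B x y * sandwich C E y z)
    = (sandwich (A ** C) (E ** B) x z - rank_one (A ** B) (E ** C) x z / n) / 2"
proof -
  have "trace (B ** T x ** A ** (C ** T z ** E)) = sandwich (A ** C) (E ** B) x z"
    using trace_mul_sym[of B "T x ** A ** C ** T z ** E"] by (simp add: sandwich_def matrix_mul_assoc)
  moreover have "trace (B ** T x ** A) = trace (T x ** (A ** B))"
    using trace_mul_sym[of B "T x ** A"] by (simp add: matrix_mul_assoc)
  moreover have "trace (C ** T z ** E) = trace (T z ** (E ** C))"
    using trace_mul_sym[of C "T z ** E"] by (simp add: matrix_mul_assoc)
  ultimately show ?thesis
    using sum_trace_trace[of "B ** T x ** A" "C ** T z ** E"]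
    by (simp only: sandwich_alt(1)[of A B] sandwich_alt(2)[of C E] rank_one_def)
qed

text \<open>The trace of the product of two index-space matrices, as a bilinear form on kernels, so
  that a trace of four factors expands termwise.\<close>

definition pairing :: "('k \<Rightarrow> 'k \<Rightarrow> complex) \<Rightarrow> ('k \<Rightarrow> 'k \<Rightarrow> complex) \<Rightarrow> complex" where
  "pairing g h = (\<Sum>x\<in>UNIV. \<Sum>z\<in>UNIV. g x z * h z x)"

lemma pairing_linear:
  "pairing (\<lambda>x z. p x z + q x z) h = pairing p h + pairing q h"
  "pairing (\<lambda>x z. p x z - q x z) h = pairing p h - pairing q h"
  "pairing (\<lambda>x z. k * p x z) h = k * pairing p h"
  "pairing h (\<lambda>x z. p x z + q x z) = pairing h p + pairing h q"
  "pairing h (\<lambda>x z. p x z - q x z) = pairing h p - pairing h q"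
  "pairing h (\<lambda>x z. k * p x z) = k * pairing h p"
  by (simp_all add: pairing_def algebra_simps sum.distrib sum_subtractf sum_distrib_left)

lemma pairing_commute: "pairing g h = pairing h g"
  unfolding pairing_def by (subst sum.swap) (simp add: mult.commute)

lemma sum_sandwich_diag: "(\<Sum>x\<in>UNIV. sandwich A B x x) = (trace A * trace B - trace (A ** B) / n) / 2"
  unfolding sandwich_def by (rule sum_trace_around)

lemma sum_rank_one_diag:
  "(\<Sum>x\<in>UNIV. rank_one U V x x) = (trace (U ** V) - trace U * trace V / n) / 2"
  using sum_trace_trace[of U V] by (simp add: rank_one_def trace_mul_sym[of _ U])

text \<open>Composition over the inner index leaves a sandwich and a rank-one kernel; summing their
  diagonals brings a further \<open>1/n\<close> correction from each.\<close>

lemma pairing_sandwiches: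
  "pairing (sandwich A B) (sandwich C E)
    = (trace (A ** C) * trace (E ** B) - trace (A ** C ** E ** B) / n
       - (trace (A ** B ** E ** C) - trace (A ** B) * trace (E ** C) / n) / n) / 4"
  unfolding pairing_def sandwich_compose sum_divide_distrib[symmetric] sum_subtractf
    sum_sandwich_diag sum_rank_one_diag
  by (simp add: matrix_mul_assoc field_simps)

text \<open>The sum over \<open>z\<close> inserts \<open>U\<close> between \<open>A\<close> and
  \<open>B\<close>, the sum over \<open>x\<close> appends \<open>V\<close>; tracelessness removes
  both \<open>1/n\<close> corrections.\<close>

lemma pairing_sandwich_rank_one:
  assumes "trace U = 0" "trace V = 0"
  shows "pairing (sandwich A B) (rank_one U V) = trace (A ** U ** B ** V) / 4"
proof -
  have inner: "(\<Sum>z\<in>UNIV. sandwich A B x z * rank_one U V z x)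
      = trace ((A ** U ** B) ** T x) * trace (T x ** V) / 2" for x
  proof -
    have "(\<Sum>z\<in>UNIV. sandwich A B x z * rank_one U V z x)
        = (\<Sum>z\<in>UNIV. trace ((B ** T x ** A) ** T z) * trace (T z ** U)) * trace (T x ** V)"
      unfolding sum_distrib_right sandwich_alt(1) rank_one_def by (simp add: mult.assoc)
    also have "\<dots> = trace (B ** T x ** A ** U) * trace (T x ** V) / 2"
      by (simp add: sum_trace_trace assms)
    also have "trace (B ** T x ** A ** U) = trace ((A ** U ** B) ** T x)"
      using trace_mul_sym[of "B ** T x" "A ** U"] by (simp add: matrix_mul_assoc)
    finally show ?thesis .
  qed
  then show ?thesis
    unfolding pairing_def inner sum_divide_distrib[symmetric] sum_trace_trace by (simp add: assms)
qed

lemma pairing_rank_one_sandwich: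
  assumes "trace U = 0" "trace V = 0"
  shows "pairing (rank_one U V) (sandwich A B) = trace (A ** U ** B ** V) / 4"
  using pairing_sandwich_rank_one[OF assms] by (simp add: pairing_commute)

text \<open>The double sum factorises into two independent contractions.\<close>

lemma pairing_rank_ones:
  assumes "trace U = 0" "trace V = 0"
  shows "pairing (rank_one U V) (rank_one U' V') = trace (U ** V') * trace (V ** U') / 4"
proof -
  have "pairing (rank_one U V) (rank_one U' V')
      = (\<Sum>x\<in>UNIV. trace (U ** T x) * trace (T x ** V')) * (\<Sum>z\<in>UNIV. trace (V ** T z) * trace (T z ** U'))"
    unfolding pairing_def sum_product
    by (simp add: rank_one_def trace_mul_sym[of U] trace_mul_sym[of V] mult_ac)
  then show ?thesis
    by (simp add: sum_trace_trace assms)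
qed

section \<open>Commutator and anticommutator matrices\<close>

text \<open>Up to a scalar, \<open>ad s a\<close> is \<open>F\<^sub>a\<close> for \<open>s = -1\<close> and \<open>D\<^sub>a\<close> for \<open>s = 1\<close>.\<close>

definition ad :: "complex \<Rightarrow> 'k \<Rightarrow> complex^'k^'k" where
  "ad s a = (\<chi> x y. trace (T x ** T a ** T y) + s * trace (T a ** T x ** T y))"

text \<open>This is half the matrix of the traceless part of \<open>T a ** X + s X ** T a\<close>:
  the commutator for \<open>s = -1\<close>, the anticommutator for \<open>s = 1\<close>.\<close>

lemma ad_nth: "ad s a $ x $ y = sandwich (T a) (mat 1) x y + s * sandwich (mat 1) (T a) x y"
  using trace_mul_sym[of "T a" "T x ** T y"]
  by (simp add: ad_def sandwich_def matrix_mul_assoc)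

text \<open>All four compositions produce the same rank-one kernel, so its coefficients add up to
  \<open>(1 + s) * (1 + t)\<close>, which vanishes as soon as one factor is a commutator.\<close>

lemma ad_mult_nth:
  "(ad s a ** ad t b) $ x $ z
    = 1 / 2 * (sandwich (T a ** T b) (mat 1) x z + t * sandwich (T a) (T b) x z
       + s * sandwich (T b) (T a) x z + s * t * sandwich (mat 1) (T b ** T a) x z
       - (1 + s) * (1 + t) / n * rank_one (T a) (T b) x z)"
proof -
  have "(ad s a ** ad t b) $ x $ z
    = (\<Sum>y\<in>UNIV. sandwich (T a) (mat 1) x y * sandwich (T b) (mat 1) y z)
      + t * (\<Sum>y\<in>UNIV. sandwich (T a) (mat 1) x y * sandwich (mat 1) (T b) y z)
      + s * (\<Sum>y\<in>UNIV. sandwich (mat 1) (T a) x y * sandwich (T b) (mat 1) y z)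
      + s * t * (\<Sum>y\<in>UNIV. sandwich (mat 1) (T a) x y * sandwich (mat 1) (T b) y z)"
    unfolding matrix_mult_nth ad_nth sum_distrib_left sum.distrib[symmetric]
    by (rule sum.cong) (simp_all add: algebra_simps)
  then show ?thesis
    unfolding sandwich_compose by (simp add: algebra_simps add_divide_distrib diff_divide_distrib)
qed

lemma trace_ad_mult4:
  "trace (ad s a ** ad t b ** ad u c ** ad v e) = pairing
    (\<lambda>x z. 1 / 2 * (sandwich (T a ** T b) (mat 1) x z + t * sandwich (T a) (T b) x z
       + s * sandwich (T b) (T a) x z + s * t * sandwich (mat 1) (T b ** T a) x z
       - (1 + s) * (1 + t) / n * rank_one (T a) (T b) x z))
    (\<lambda>x z. 1 / 2 * (sandwich (T c ** T e) (mat 1) x z + v * sandwich (T c) (T e) x z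
       + u * sandwich (T e) (T c) x z + u * v * sandwich (mat 1) (T e ** T c) x z
       - (1 + u) * (1 + v) / n * rank_one (T c) (T e) x z))"
proof -
  have "ad s a ** ad t b ** ad u c ** ad v e = (ad s a ** ad t b) ** (ad u c ** ad v e)"
    by (simp add: matrix_mul_assoc)
  then show ?thesis
    by (simp only: trace_mult_nth[of "ad s a ** ad t b"] ad_mult_nth pairing_def)
qed

text \<open>The signs \<open>s\<close> and \<open>t\<close> cover every contraction of
  \<open>f\<close> and \<open>d\<close> at once. The delta term collects the products of traces from
  the four Fierz corrections.\<close>

lemma sum_contraction:
  "(\<Sum>x\<in>UNIV. (trace (T a ** T b ** T x) + s * trace (T b ** T a ** T x))
        * (trace (T c ** T e ** T x) + t * trace (T e ** T c ** T x)))
    = (trace (T a ** T b ** T c ** T e) + t * trace (T a ** T b ** T e ** T c)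
       + s * trace (T b ** T a ** T c ** T e) + s * t * trace (T b ** T a ** T e ** T c)
       - (1 + s) * (1 + t) * kdelta a b * kdelta c e / (4 * n)) / 2"
proof -
  have S: "(\<Sum>x\<in>UNIV. trace (A ** T x) * trace (B ** T x)) = (trace (A ** B) - trace A * trace B / n) / 2" for A B
    using sum_trace_trace[of A B] by (simp add: trace_mul_sym[of B])
  have "(\<Sum>x\<in>UNIV. (trace (T a ** T b ** T x) + s * trace (T b ** T a ** T x))
        * (trace (T c ** T e ** T x) + t * trace (T e ** T c ** T x)))
    = (\<Sum>x\<in>UNIV. trace (T a ** T b ** T x) * trace (T c ** T e ** T x))
      + t * (\<Sum>x\<in>UNIV. trace (T a ** T b ** T x) * trace (T e ** T c ** T x))
      + s * (\<Sum>x\<in>UNIV. trace (T b ** T a ** T x) * trace (T c ** T e ** T x))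
      + s * t * (\<Sum>x\<in>UNIV. trace (T b ** T a ** T x) * trace (T e ** T c ** T x))"
    unfolding sum_distrib_left sum.distrib[symmetric]
    by (rule sum.cong) (simp_all add: algebra_simps)
  also have "\<dots> = (trace (T a ** T b ** T c ** T e) + t * trace (T a ** T b ** T e ** T c)
       + s * trace (T b ** T a ** T c ** T e) + s * t * trace (T b ** T a ** T e ** T c)
       - (1 + s) * (1 + t) * kdelta a b * kdelta c e / (4 * n)) / 2"
    unfolding S by (simp add: trace_generators kdelta_commute[of b a] kdelta_commute[of e c]
        matrix_mul_assoc field_simps)
  finally show ?thesis .
qed

end

section \<open>The tensors as traces of three generators\<close>

locale su_structure = su_generators T n for T :: "'k::finite \<Rightarrow> complex^'n^'n" and n +
  fixes f d :: "'k \<Rightarrow> 'k \<Rightarrow> 'k \<Rightarrow> complex"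
  assumes tensors: "su_tensors T f d"
begin

text \<open>The redundant factors \<open>-1\<close> and \<open>1\<close> here and in \<open>d_trace\<close> are the parameter \<open>s\<close> of \<open>ad\<close>.\<close>

lemma f_trace: "f a b c = - 2 * \<i> * (trace (T a ** T b ** T c) + (-1) * trace (T b ** T a ** T c))"
proof -
  have "trace ((T a ** T b - T b ** T a) ** T c) = trace ((\<Sum>x\<in>UNIV. cscale (\<i> * f a b x) (T x)) ** T c)"
    using tensors by (simp add: su_tensors_def)
  also have "\<dots> = \<i> * f a b c / 2"
    by (simp add: sum_mult_left trace_sum cscale_mult_left trace_cscale trace_generators
        sum_divide_distrib[symmetric] sum_kdelta)
  finally have "\<i> * f a b c = 2 * (trace (T a ** T b ** T c) - trace (T b ** T a ** T c))"
    by (simp add: matrix_diff_rdistrib trace_sub field_simps)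
  \<comment> \<open>Multiplying by \<open>- \<i>\<close> cancels the factor \<open>\<i>\<close> on
    the left.\<close>
  then have "- \<i> * (\<i> * f a b c) = - \<i> * (2 * (trace (T a ** T b ** T c) - trace (T b ** T a ** T c)))"
    by (rule arg_cong)
  then show ?thesis by simp
qed

lemma d_trace: "d a b c = 2 * (trace (T a ** T b ** T c) + 1 * trace (T b ** T a ** T c))"
proof -
  have "trace ((T a ** T b + T b ** T a) ** T c)
      = trace ((mat (kdelta a b / of_nat CARD('n)) + (\<Sum>x\<in>UNIV. cscale (d a b x) (T x))) ** T c)"
    using tensors by (simp add: su_tensors_def)
  \<comment> \<open>The unit-matrix term drops out because \<open>T c\<close> is traceless;
    orthogonality selects \<open>x = c\<close>.\<close>
  also have "\<dots> = d a b c / 2"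
    by (simp add: matrix_add_rdistrib mat_mult_left trace_add generator sum_mult_left trace_sum
        cscale_mult_left trace_cscale trace_generators sum_divide_distrib[symmetric] sum_kdelta)
  finally show ?thesis
    by (simp add: matrix_add_rdistrib trace_add field_simps)
qed

text \<open>Conjugation reverses the product of hermitian factors, and cyclicity turns the reversal
  into a swap of the first two.\<close>

lemma cnj_trace3: "cnj (trace (T a ** T b ** T c)) = trace (T b ** T a ** T c)"
proof -
  have "conj_transpose (T a ** T b ** T c) = T c ** (T b ** T a)"
    using generator(1) by (simp add: conj_transpose_mult hermitian_def)
  then show ?thesis
    using trace_mul_sym[of "T c" "T b ** T a"]
    by (simp flip: trace_conj_transpose)
qed

lemma trace3_cycle: "trace (T b ** T c ** T a) = trace (T a ** T b ** T c)"
  using trace_mul_sym[of "T b ** T c" "T a"] by (simp add: matrix_mul_assoc)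

lemma F_eq_ad: "F_matrix f a = cscale (- 2 * \<i>) (ad (-1) a)"
  by (simp add: vec_eq_iff F_matrix_def ad_def f_trace)

lemma D_eq_ad: "D_matrix d a = cscale 2 (ad 1 a)"
  by (simp add: vec_eq_iff D_matrix_def ad_def d_trace)

text \<open>Conjugation leaves the entries fixed, while exchanging the two matrix indices swaps the
  two traces up to cyclicity. The relative sign of these traces makes \<open>F_matrix\<close>
  antihermitian and \<open>D_matrix\<close> hermitian.\<close>

lemma antihermitian_F: "antihermitian (F_matrix f a)"
  unfolding antihermitian_def vec_eq_iff
  by (simp add: F_matrix_def f_trace cnj_trace3)
    (simp add: trace3_cycle algebra_simps)

lemma hermitian_D: "hermitian (D_matrix d a)"
  unfolding hermitian_def vec_eq_iff
  by (simp add: D_matrix_def d_trace cnj_trace3)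
    (simp add: trace3_cycle algebra_simps)

lemma trace_ad: "trace (ad s a) = 0"
proof -
  have "(\<Sum>x\<in>UNIV. sandwich A B x x) = 0" if "trace (A ** B) = 0" "trace A * trace B = 0" for A B
    using that by (simp add: sum_sandwich_diag)
  then show ?thesis
    by (simp add: trace_def[of "ad s a"] ad_nth sum.distrib sum_distrib_left[symmetric] generator)
qed

section \<open>Reduction to four-generator traces and the six identities\<close>

lemma contract_scaled:
  assumes "\<And>x. X a b x = k * (trace (T a ** T b ** T x) + s * trace (T b ** T a ** T x))"
    and "\<And>x. Y c e x = l * (trace (T c ** T e ** T x) + t * trace (T e ** T c ** T x))"
  shows "contract X Y a b c e = k * l *
    ((trace (T a ** T b ** T c ** T e) + t * trace (T a ** T b ** T e ** T c)
       + s * trace (T b ** T a ** T c ** T e) + s * t * trace (T b ** T a ** T e ** T c)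
       - (1 + s) * (1 + t) * kdelta a b * kdelta c e / (4 * n)) / 2)"
  unfolding sum_contraction[symmetric] contract_def assms
  by (simp add: sum_distrib_left mult_ac)

lemmas contract_trace =
  contract_scaled[where X = d and Y = d, OF d_trace d_trace]
  contract_scaled[where X = d and Y = f, OF d_trace f_trace]
  contract_scaled[where X = f and Y = d, OF f_trace d_trace]

text \<open>Left-hand sides pass through \<open>ad\<close> and \<open>pairing\<close>, right-hand
  sides through \<open>contract_trace\<close>; both end in four-generator traces and Kronecker
  deltas.\<close>

lemmas trace_product_simps =
  F_eq_ad D_eq_ad cscale_mult_left cscale_mult_right trace_cscale trace_ad_mult4
  pairing_linear pairing_sandwiches
  pairing_sandwich_rank_one[OF generator(2) generator(2)]
  pairing_rank_one_sandwich[OF generator(2) generator(2)]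
  pairing_rank_ones[OF generator(2) generator(2)] contract_trace matrix_mul_assoc
  matrix_mul_lid matrix_mul_rid trace_generators generator(2) trace_mat n_def[symmetric]

lemma trace4_cycle:
  "trace (T x ** T y ** T z ** T w) = trace (T w ** T x ** T y ** T z)"
  "trace (T x ** T y ** T z ** T w) = trace (T z ** T w ** T x ** T y)"
  "trace (T x ** T y ** T z ** T w) = trace (T y ** T z ** T w ** T x)"
  using trace_mul_sym[of "T x ** T y ** T z" "T w"] trace_mul_sym[of "T x ** T y" "T z ** T w"]
    trace_mul_sym[of "T x" "T y ** T z ** T w"]
  by (simp_all add: matrix_mul_assoc)

text \<open>Cyclically moving \<open>T\<^sub>a\<close> to the front leaves six traces of four generators, one for each
  order of \<open>b, c, e\<close>; both sides are linear in them and in the products of Kronecker deltas.\<close>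

lemma trace_FFFF:
  "trace (F_matrix f a ** F_matrix f b ** F_matrix f c ** F_matrix f e)
         = kdelta a b * kdelta c e + kdelta a e * kdelta b c
           + n / 4 * (contract d d a b c e + contract d d a e b c - contract d d a c b e)"
  unfolding trace_product_simps
  \<comment> \<open>The delta arguments are also put in the order \<open>a\<close>,
    \<open>b\<close>, \<open>c\<close>, \<open>e\<close>; the second simplification clears the
    powers of \<open>n\<close> and compares coefficients.\<close>
  by (simp add: trace4_cycle(1)[of _ _ _ a] trace4_cycle(2)[of _ _ a] trace4_cycle(3)[of _ a]
      kdelta_commute[of _ a] kdelta_commute[of e] kdelta_commute[of c b])
    (simp add: field_simps power2_eq_square)

lemma trace_FFFD:
  "trace (F_matrix f a ** F_matrix f b ** F_matrix f c ** D_matrix d e)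
         = - (n / 4) * contract d f a b c e - n / 4 * contract f d a b c e"
  unfolding trace_product_simps
  by (simp add: trace4_cycle(1)[of _ _ _ a] trace4_cycle(2)[of _ _ a] trace4_cycle(3)[of _ a]
      kdelta_commute[of _ a] kdelta_commute[of e] kdelta_commute[of c b])
    (simp add: field_simps power2_eq_square)

lemma trace_FFDD:
  "trace (F_matrix f a ** F_matrix f b ** D_matrix d c ** D_matrix d e)
         = (4 - n^2) / n^2 * (kdelta a b * kdelta c e - kdelta a c * kdelta b e)
           + (8 - n^2) / (4 * n) * (contract d d a b c e - contract d d a c b e)
           - n / 4 * contract d d a e b c"
  unfolding trace_product_simps
  by (simp add: trace4_cycle(1)[of _ _ _ a] trace4_cycle(2)[of _ _ a] trace4_cycle(3)[of _ a]
      kdelta_commute[of _ a] kdelta_commute[of e] kdelta_commute[of c b])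
    (simp add: field_simps power2_eq_square)

lemma trace_FDFD:
  "trace (F_matrix f a ** D_matrix d b ** F_matrix f c ** D_matrix d e)
         = n / 4 * (contract d d a c b e - contract d d a e b c) - n / 4 * contract d d a b c e"
  unfolding trace_product_simps
  by (simp add: trace4_cycle(1)[of _ _ _ a] trace4_cycle(2)[of _ _ a] trace4_cycle(3)[of _ a]
      kdelta_commute[of _ a] kdelta_commute[of e] kdelta_commute[of c b])
    (simp add: field_simps power2_eq_square)

lemma trace_FDDD:
  "trace (F_matrix f a ** D_matrix d b ** D_matrix d c ** D_matrix d e)
         = (n^2 - 12) / (4 * n) * contract f d a b c e + n / 4 * contract d f a b c e
           + 1 / n * (contract f d a e b c - contract f d a c b e)"
  unfolding trace_product_simps
  by (simp add: trace4_cycle(1)[of _ _ _ a] trace4_cycle(2)[of _ _ a] trace4_cycle(3)[of _ a]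
      kdelta_commute[of _ a] kdelta_commute[of e] kdelta_commute[of c b])
    (simp add: field_simps power2_eq_square)

lemma trace_DDDD:
  "trace (D_matrix d a ** D_matrix d b ** D_matrix d c ** D_matrix d e)
         = (n^2 - 4) / n^2 * (kdelta a b * kdelta c e + kdelta a e * kdelta b c)
           - n / 4 * contract d d a c b e
           + (n^2 - 16) / (4 * n) * (contract d d a b c e + contract d d a e b c)"
  unfolding trace_product_simps
  by (simp add: trace4_cycle(1)[of _ _ _ a] trace4_cycle(2)[of _ _ a] trace4_cycle(3)[of _ a]
      kdelta_commute[of _ a] kdelta_commute[of e] kdelta_commute[of c b])
    (simp add: field_simps power2_eq_square)

end

theorem mainTheorem14:
  fixes T :: "'k::finite \<Rightarrow> complex^'n^'n"
    and f d :: "'k \<Rightarrow> 'k \<Rightarrow> 'k \<Rightarrow> complex"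
    and F D :: "'k \<Rightarrow> complex^'k^'k"
    and n :: complex
  assumes "su_tensors T f d"
    and "F = F_matrix f" and "D = D_matrix d"
    and "n = of_nat CARD('n)"
  shows
    "(\<forall>a. antihermitian (F a) \<and> trace (F a) = 0 \<and> hermitian (D a) \<and> trace (D a) = 0) \<and>
     (\<forall>a b c e.
       trace (F a ** F b ** F c ** F e)
         = kdelta a b * kdelta c e + kdelta a e * kdelta b c
           + n / 4 * (contract d d a b c e + contract d d a e b c - contract d d a c b e) \<and>
       trace (F a ** F b ** F c ** D e)
         = - (n / 4) * contract d f a b c e - n / 4 * contract f d a b c e \<and>
       trace (F a ** F b ** D c ** D e)
         = (4 - n^2) / n^2 * (kdelta a b * kdelta c e - kdelta a c * kdelta b e)
           + (8 - n^2) / (4 * n) * (contract d d a b c e - contract d d a c b e)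
           - n / 4 * contract d d a e b c \<and>
       trace (F a ** D b ** F c ** D e)
         = n / 4 * (contract d d a c b e - contract d d a e b c) - n / 4 * contract d d a b c e \<and>
       trace (F a ** D b ** D c ** D e)
         = (n^2 - 12) / (4 * n) * contract f d a b c e + n / 4 * contract d f a b c e
           + 1 / n * (contract f d a e b c - contract f d a c b e) \<and>
       trace (D a ** D b ** D c ** D e)
         = (n^2 - 4) / n^2 * (kdelta a b * kdelta c e + kdelta a e * kdelta b c)
           - n / 4 * contract d d a c b e
           + (n^2 - 16) / (4 * n) * (contract d d a b c e + contract d d a e b c))"
proof -
  interpret su_structure T n f d
    using assms by unfold_locales (auto simp: su_tensors_def)
  have "trace (F_matrix f a) = 0" "trace (D_matrix d a) = 0" for a
    by (simp_all add: F_eq_ad D_eq_ad trace_cscale trace_ad)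
  then show ?thesis
    unfolding assms(2,3)
    by (intro conjI allI antihermitian_F hermitian_D trace_FFFF trace_FFFD trace_FFDD trace_FDFD
        trace_FDDD trace_DDDD) simp_all
qed

end
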